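(* For every integer $c\geq 1$ and every integer $s$ with $0\leq s\leq 3c$ and $s\neq 1$, there exist infinitely many connected unbalanced signed graphs $(G,\sigma)$ with $c(G)=c$ such that $$\eta(G,\sigma)=|V(G)|-2m(G)+2c(G)-s.$$
   Context: All graphs are finite and simple. A signed graph $(G,\sigma)$ is a graph $G$ with a map $\sigma:E(G)\to\{+,-\}$; its adjacency matrix $A(G,\sigma)$ has $(i,j)$-entry $\sigma(v_iv_j)$ if $v_iv_j\in E(G)$ and $0$ otherwise. The nullity $\eta(G,\sigma)$ is the multiplicity of $0$ as an eigenvalue of $A(G,\sigma)$. The sign of a cycle is the product of the signs of its edges; $(G,\sigma)$ is balanced if every cycle is positive, unbalanced otherwise (so an unbalanced signed graph has $c(G)\ge 1$). $m(G)$ is the matching number of $G$, and $c(G)=|E(G)|-|V(G)|+\theta(G)$, where $\theta(G)$ is the number of connected components of $G$. *)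

theory Defs
  imports
    "HOL-Library.FuncSet"
    "HOL-Library.Disjoint_Sets"
    "Graph_Theory.Graph_Theory"
    "Jordan_Normal_Form.Char_Poly"
begin

text \<open>
  Finite simple graphs are the \<^locale>\<open>pair_graph\<close>s of Graph_Theory: finite, loop-free, symmetric
  digraphs whose arcs are pairs of vertices. An undirected edge \<open>{u, v}\<close> is thus represented by
  the two arcs \<open>(u, v)\<close> and \<open>(v, u)\<close>.
\<close>

definition edges :: "'a pair_pre_digraph \<Rightarrow> 'a set set" where
  "edges G = {{u, v} | u v. (u, v) \<in> parcs G}"

definition signed_graph :: "'a pair_pre_digraph \<Rightarrow> ('a set \<Rightarrow> int) \<Rightarrow> bool" where
  "signed_graph G \<sigma> \<longleftrightarrow> pair_graph G \<and> \<sigma> \<in> edges G \<rightarrow>\<^sub>E {1, -1}"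

text \<open>
  The vertices are numbered in increasing order; any other numbering gives a
  permutation-similar matrix.
\<close>
definition adjacency_mat ::
    "'a::linorder pair_pre_digraph \<Rightarrow> ('a set \<Rightarrow> int) \<Rightarrow> real mat" where
  "adjacency_mat G \<sigma> =
     (let vs = sorted_list_of_set (pverts G); n = card (pverts G)
      in mat n n (\<lambda>(i, j).
           if (vs ! i, vs ! j) \<in> parcs G then of_int (\<sigma> {vs ! i, vs ! j}) else 0))"

definition nullity :: "'a::linorder pair_pre_digraph \<Rightarrow> ('a set \<Rightarrow> int) \<Rightarrow> nat" where
  "nullity G \<sigma> = Polynomial.order 0 (char_poly (adjacency_mat G \<sigma>))"

text \<open>
  In a symmetric digraph \<^const>\<open>pre_digraph.cycle\<close> also admits the closed walks
  \<open>(u, v), (v, u)\<close>, which are not cycles of the undirected graph; hence the bound on the length.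
\<close>
definition graph_cycle :: "'a pair_pre_digraph \<Rightarrow> ('a \<times> 'a) list \<Rightarrow> bool" where
  "graph_cycle G p \<longleftrightarrow> pre_digraph.cycle (with_proj G) p \<and> 3 \<le> length p"

definition cycle_sign :: "('a set \<Rightarrow> int) \<Rightarrow> ('a \<times> 'a) list \<Rightarrow> int" where
  "cycle_sign \<sigma> p = prod_list (map (\<lambda>(u, v). \<sigma> {u, v}) p)"

definition balanced :: "'a pair_pre_digraph \<Rightarrow> ('a set \<Rightarrow> int) \<Rightarrow> bool" where
  "balanced G \<sigma> \<longleftrightarrow> (\<forall>p. graph_cycle G p \<longrightarrow> cycle_sign \<sigma> p = 1)"

definition matching :: "'a pair_pre_digraph \<Rightarrow> 'a set set \<Rightarrow> bool" where
  "matching G M \<longleftrightarrow> M \<subseteq> edges G \<and> disjoint M"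

definition matching_number :: "'a pair_pre_digraph \<Rightarrow> nat" where
  "matching_number G = Max (card ` {M. matching G M})"

text \<open>
  As the digraph is symmetric, its strongly connected components are the connected components of
  the graph.
\<close>
definition num_components :: "'a pair_pre_digraph \<Rightarrow> nat" where
  "num_components G = card (pre_digraph.sccs (with_proj G))"

definition cyclomatic_number :: "'a pair_pre_digraph \<Rightarrow> int" where
  "cyclomatic_number G =
     int (card (edges G)) - int (card (pverts G)) + int (num_components G)"

end

theory Submission
  imports Defs
begin

text \<open>
  Attach \<open>c\<close> disjoint unbalanced cycles of lengths \<open>3\<close>, \<open>4\<close> or \<open>6\<close> by one edge each to a common hub
  that also has pendant leaves. A leaf forces every kernel vector of the adjacency matrix to vanish
  at the hub, so the kernel splits into the kernels of the cycles and the values at the leaves, which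
  are subject only to the hub equation. Compared with \<open>|V| - 2 m + 2 c\<close>, each cycle of length \<open>3\<close>, \<open>4\<close>,
  \<open>6\<close> lowers the nullity by \<open>3\<close>, \<open>2\<close>, \<open>0\<close>. The sums of \<open>c\<close> numbers from \<open>{0, 2, 3}\<close> are exactly the
  \<open>s \<le> 3 c\<close> with \<open>s \<noteq> 1\<close>, and varying the number of leaves gives infinitely many graphs.
\<close>

section \<open>The nullity of a real symmetric matrix\<close>

lemma det_mat_diag:
  fixes d :: "nat \<Rightarrow> 'a :: comm_ring_1"
  shows "det (mat_diag n d) = (\<Prod>i<n. d i)"
proof -
  have "det (mat_diag n d) = prod_list (diag_mat (mat_diag n d))"
    by (rule det_upper_triangular[of _ n]) (auto simp: mat_diag_def)
  also have "\<dots> = (\<Prod>i<n. d i)"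
    by (simp add: prod_list_diag_prod mat_diag_def atLeast0LessThan)
  finally show ?thesis .
qed

lemma poly_det: "poly (det Q) x = det (map_mat (\<lambda>p. poly p x) (Q :: 'a :: comm_ring_1 poly mat))"
proof -
  have "comm_ring_hom (\<lambda>p::'a poly. poly p x)" by unfold_locales auto
  thus ?thesis by (rule comm_ring_hom.hom_det[symmetric])
qed

text \<open>
  With \<open>K\<close> the kernel basis dual to the coordinates in \<open>F\<close>, let \<open>P\<close> have the columns of \<open>K\<close> at \<open>F\<close>
  and unit columns elsewhere. The columns of \<open>(x I - A) P\<close> at \<open>F\<close> are \<open>x\<close> times those of \<open>K\<close>; pulling
  out these factors leaves a matrix \<open>Q\<close> that is regular at \<open>x = 0\<close>, because the kernel and the
  range of a real symmetric matrix meet only in \<open>0\<close>.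
\<close>
lemma order_char_poly_symmetric:
  fixes A :: "real mat"
  assumes A: "A \<in> carrier_mat n n" and sym: "transpose_mat A = A" and F: "F \<subseteq> {..<n}"
    and ex: "\<And>j. j \<in> F \<Longrightarrow> \<exists>v \<in> carrier_vec n. A *\<^sub>v v = 0\<^sub>v n \<and> (\<forall>i\<in>F. v $ i = (if i = j then 1 else 0))"
    and uniq: "\<And>v. \<lbrakk>v \<in> carrier_vec n; A *\<^sub>v v = 0\<^sub>v n; \<forall>i\<in>F. v $ i = 0\<rbrakk> \<Longrightarrow> v = 0\<^sub>v n"
  shows "Polynomial.order 0 (char_poly A) = card F"
proof -
  obtain K where K: "\<And>j. j \<in> F \<Longrightarrow> K j \<in> carrier_vec n"
    and AK: "\<And>j. j \<in> F \<Longrightarrow> A *\<^sub>v K j = 0\<^sub>v n"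
    and KF: "\<And>i j. j \<in> F \<Longrightarrow> i \<in> F \<Longrightarrow> K j $ i = (if i = j then 1 else 0)"
    using ex by metis
  define P where "P = mat n n (\<lambda>(i,j). if j \<in> F then K j $ i else if i = j then 1 else 0)"
  define Q where "Q = mat n n (\<lambda>(i,j). if j \<in> F then [:K j $ i:]
     else [:- A $$ (i,j), if i = j then 1 else 0:])"
  define d :: "nat \<Rightarrow> real poly" where "d = (\<lambda>j. if j \<in> F then [:0,1:] else 1)"
  let ?P = "map_mat (\<lambda>a. [:a:]) P"
  have P: "P \<in> carrier_mat n n" and Q: "Q \<in> carrier_mat n n" by (auto simp: P_def Q_def)
  have AP: "(\<Sum>l<n. A $$ (i,l) * P $$ (l,j)) = (if j \<in> F then 0 else A $$ (i,j))"
    if "i < n" "j < n" for i j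
  proof (cases "j \<in> F")
    case True
    have "(A *\<^sub>v K j) $ i = 0" using AK[OF True] that by simp
    thus ?thesis using that A True K[OF True]
      by (simp add: scalar_prod_def P_def atLeast0LessThan)
  next
    case False
    hence "(\<Sum>l<n. A $$ (i,l) * P $$ (l,j)) = (\<Sum>l<n. if l = j then A $$ (i,j) else 0)"
      using that by (intro sum.cong) (auto simp: P_def)
    thus ?thesis using that False by simp
  qed
  have "char_poly_matrix A * ?P = Q * mat_diag n d"
  proof (rule eq_matI)
    fix i j assume "i < dim_row (Q * mat_diag n d)" "j < dim_col (Q * mat_diag n d)"
    hence ij: "i < n" "j < n" using Q by (auto simp: mat_diag_def)
    have "(char_poly_matrix A * ?P) $$ (i,j)
        = (\<Sum>l<n. ([:0,1:] * (if l = i then 1 else 0) + [:- A $$ (i,l):]) * [:P $$ (l,j):])"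
      using ij A P by (auto simp: char_poly_matrix_def scalar_prod_def atLeast0LessThan intro!: sum.cong)
    also have "\<dots> = (\<Sum>l<n. if l = i then [:0, P $$ (l,j):] else 0) - (\<Sum>l<n. [:A $$ (i,l) * P $$ (l,j):])"
      unfolding sum_subtractf[symmetric]
      by (intro sum.cong) (auto simp: mult.commute)
    also have "\<dots> = [:0, P $$ (i,j):] - [:\<Sum>l<n. A $$ (i,l) * P $$ (l,j):]"
      using ij by (simp add: sum_to_poly)
    also have "\<dots> = Q $$ (i,j) * d j"
      using ij unfolding AP[OF ij] by (simp add: Q_def d_def P_def)
    also have "\<dots> = (Q * mat_diag n d) $$ (i,j)"
      using ij Q by (simp add: mat_diag_mult_right[OF Q])
    finally show "(char_poly_matrix A * ?P) $$ (i,j) = (Q * mat_diag n d) $$ (i,j)" .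
  qed (use A P Q in \<open>auto simp: mat_diag_def char_poly_matrix_def\<close>)
  hence "det (char_poly_matrix A) * det ?P = det Q * det (mat_diag n d)"
    using A P Q by (metis det_mult char_poly_matrix_closed map_carrier_mat mat_diag_dim)
  moreover have "det ?P = [:det P:]"
  proof -
    have "comm_ring_hom (\<lambda>a::real. [:a:])" by unfold_locales (auto simp: one_pCons)
    thus ?thesis by (rule comm_ring_hom.hom_det)
  qed
  moreover have "(\<Prod>j<n. d j) = [:0,1:] ^ card F"
    unfolding d_def using F by (subst prod.If_cases) (auto simp: Int_absorb1)
  ultimately have eq: "char_poly A * [:det P:] = det Q * [:0,1:] ^ card F"
    by (simp add: char_poly_def det_mat_diag)
  have Q0: "poly (det Q) 0 \<noteq> 0"
  proof
    let ?Q = "map_mat (\<lambda>p. poly p 0) Q"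
    assume "poly (det Q) 0 = 0"
    hence "det ?Q = 0" by (simp add: poly_det)
    then obtain w where w: "w \<in> carrier_vec n" "w \<noteq> 0\<^sub>v n" "?Q *\<^sub>v w = 0\<^sub>v n"
      using det_0_iff_vec_prod_zero[of ?Q n] Q by auto
    \<comment> \<open>Here \<open>a\<close> combines the kernel vectors \<open>K j\<close>, so it
      lies in the kernel, and \<open>b\<close> is \<open>w\<close> cut off on \<open>F\<close>. The
      equation for \<open>w\<close> says precisely that \<open>a = A b\<close>.\<close>
    define a where "a = vec n (\<lambda>i. \<Sum>j\<in>F. K j $ i * w $ j)"
    define b where "b = vec n (\<lambda>j. if j \<in> F then 0 else w $ j)"
    have ab: "a \<in> carrier_vec n" "b \<in> carrier_vec n" by (auto simp: a_def b_def)
    have aAb: "a = A *\<^sub>v b"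
    proof (rule eq_vecI)
      fix i assume "i < dim_vec (A *\<^sub>v b)"
      hence i: "i < n" using A by simp
      have "0 = (?Q *\<^sub>v w) $ i" using w i by simp
      also have "\<dots> = (\<Sum>j<n. (if j \<in> F then K j $ i * w $ j else - (A $$ (i,j) * w $ j)))"
        using i w(1) Q by (auto simp: scalar_prod_def Q_def atLeast0LessThan intro!: sum.cong)
      also have "\<dots> = (\<Sum>j<n. (if j \<in> F then K j $ i * w $ j else 0)) - (\<Sum>j<n. A $$ (i,j) * b $ j)"
        unfolding sum_subtractf[symmetric] by (intro sum.cong) (auto simp: b_def)
      also have "(\<Sum>j<n. (if j \<in> F then K j $ i * w $ j else 0)) = a $ i"
        using i F by (simp add: a_def sum.If_cases Int_absorb1)
      also have "(\<Sum>j<n. A $$ (i,j) * b $ j) = (A *\<^sub>v b) $ i"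
        using i A ab by (simp add: scalar_prod_def atLeast0LessThan)
      finally show "a $ i = (A *\<^sub>v b) $ i" by simp
    qed (use A in \<open>simp add: a_def\<close>)
    have Aa: "A *\<^sub>v a = 0\<^sub>v n"
    proof (rule eq_vecI)
      fix i assume "i < dim_vec (0\<^sub>v n :: real vec)"
      hence i: "i < n" by simp
      have "(A *\<^sub>v a) $ i = (\<Sum>l<n. A $$ (i,l) * (\<Sum>j\<in>F. K j $ l * w $ j))"
        using i A by (simp add: scalar_prod_def a_def atLeast0LessThan)
      also have "\<dots> = (\<Sum>j\<in>F. (\<Sum>l<n. A $$ (i,l) * K j $ l) * w $ j)"
        unfolding sum_distrib_left sum_distrib_right mult.assoc by (rule sum.swap)
      also have "\<dots> = (\<Sum>j\<in>F. (A *\<^sub>v K j) $ i * w $ j)"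
        using i A carrier_vecD[OF K] by (auto simp: scalar_prod_def atLeast0LessThan)
      also have "\<dots> = 0" using i by (simp add: AK)
      finally show "(A *\<^sub>v a) $ i = 0\<^sub>v n $ i" using i by simp
    qed (use A in simp)
    \<comment> \<open>Symmetry enters here: \<open>a\<close> lies in both the kernel and the range
      of \<open>A\<close>, hence is orthogonal to itself.\<close>
    have "a \<bullet> a = (A *\<^sub>v a) \<bullet> b"
      using transpose_vec_mult_scalar[OF A ab(2,1)] by (simp add: sym flip: aAb)
    also have "\<dots> = 0" using ab by (simp add: Aa)
    finally have "(\<Sum>i<n. a $ i * a $ i) = 0"
      using ab by (simp add: scalar_prod_def atLeast0LessThan)
    hence "a $ i = 0" if "i < n" for i
      using that by (subst (asm) sum_nonneg_eq_0_iff) auto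
    hence a0: "a = 0\<^sub>v n" using ab by auto
    \<comment> \<open>By duality of the \<open>K j\<close> to the coordinates in \<open>F\<close>,
      the entry of \<open>a\<close> at \<open>i\<close> is \<open>w $ i\<close>. Hence
      \<open>b = w\<close> is a kernel vector vanishing on \<open>F\<close>.\<close>
    have wF: "w $ i = 0" if "i \<in> F" for i
    proof -
      have "0 = a $ i" using a0 that F by auto
      also have "\<dots> = (\<Sum>j\<in>F. if i = j then w $ j else 0)"
      proof -
        have "i < n" using that F by auto
        thus ?thesis using that by (auto simp: a_def KF intro!: sum.cong)
      qed
      also have "\<dots> = w $ i" using that F by (simp add: finite_subset)
      finally show ?thesis by simp
    qed
    hence "b = w" using w by (auto simp: b_def)
    hence "w = 0\<^sub>v n" using uniq[of w] w wF aAb a0 by simp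
    thus False using w by simp
  qed
  \<comment> \<open>Orders at 0 are now compared in \<open>eq\<close>: \<open>det Q\<close>
    contributes nothing, and \<open>det P\<close> is a nonzero constant, since otherwise the
    right-hand side would vanish.\<close>
  hence "det Q \<noteq> 0" "Polynomial.order 0 (det Q) = 0" by (auto intro: order_0I)
  moreover have "det P \<noteq> 0" using eq \<open>det Q \<noteq> 0\<close> by auto
  moreover have "char_poly A \<noteq> 0" using eq \<open>det Q \<noteq> 0\<close> by auto
  ultimately show ?thesis
    using arg_cong[OF eq, of "Polynomial.order 0"]
    by (simp add: order_mult order_smult order_power_n_n[of 0, simplified])
qed

section \<open>Finite graphs\<close>

text \<open>Disjoint pairs cover twice as many points as there are pairs. This bounds the matching
  edges inside one cycle.\<close>

lemma card_matching_le:
  assumes "disjoint M" "finite X" "\<And>e. e \<in> M \<Longrightarrow> card e = 2 \<and> e \<subseteq> X"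
  shows "2 * card M \<le> card X"
proof -
  have "card (\<Union>M) = sum card M"
  proof (rule card_Union_disjoint)
    show "pairwise disjnt M" using assms(1) by (auto simp: disjoint_def pairwise_def disjnt_def)
  qed (use assms in \<open>auto dest: finite_subset\<close>)
  also have "\<dots> = 2 * card M" using assms by simp
  finally show ?thesis using card_mono[OF assms(2), of "\<Union>M"] assms(3) by auto
qed

text \<open>The members of the infinite family are told apart by this invariant.\<close>

lemma digraph_iso_card_verts:
  assumes "digraph_iso G H" shows "card (verts G) = card (verts H)"
  using assms unfolding digraph_iso_def pre_digraph.digraph_isomorphism_def
  by (auto simp: verts_app_iso card_image)

text \<open>Strong components are strongly connected induced subgraphs with maximal vertex set, and
  \<open>G\<close> is an induced subgraph of itself containing every vertex.\<close>

lemma sccs_strongly_connected: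
  assumes "wf_digraph G" "strongly_connected G"
  shows "pre_digraph.sccs G = {G}"
proof -
  interpret wf_digraph G by fact
  have ind: "induced_subgraph G G" by (auto simp: induced_subgraph_def subgraph_def compatible_def wf_digraph_axioms wellformed)
  have sub: "H = G" if "induced_subgraph H G" "verts H = verts G" for H
    using that wellformed by (auto simp: induced_subgraph_def subgraph_def compatible_def intro!: pre_digraph.equality)
  have le: "verts H \<subseteq> verts G" if "induced_subgraph H G" for H
    using that by (auto simp: induced_subgraph_def subgraph_def)
  show ?thesis
    using ind sub le assms(2) unfolding sccs_def by (auto; metis psubsetI psubset_subset_trans less_irrefl)
qed

lemma num_components_strongly_connected:
  assumes "wf_digraph (with_proj G)" "strongly_connected (with_proj G)"
  shows "num_components G = 1"
  using sccs_strongly_connected[OF assms] by (simp add: num_components_def)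

section \<open>Unbalanced cycles attached to a hub\<close>

text \<open>
  An unbalanced cycle of length \<open>3\<close>, \<open>4\<close>, \<open>6\<close> has nullity \<open>0\<close>, \<open>0\<close>, \<open>2\<close>; the defect is the amount by
  which this falls short of \<open>l - 2 m + 2\<close>, where \<open>m = l div 2\<close> is its matching number.
\<close>
definition defect :: "nat \<Rightarrow> nat" where
  "defect l = (if l = 3 then 3 else if l = 4 then 2 else 0)"

text \<open>
  The equations \<open>A y = 0\<close> for the cycle \<open>0, \<dots>, l - 1\<close> whose only negative edge is \<open>{0, 1}\<close>.
\<close>
definition cell_kernel :: "nat \<Rightarrow> (nat \<Rightarrow> real) \<Rightarrow> bool" where
  "cell_kernel l y \<longleftrightarrow> (\<forall>j<l.
     (if j = 0 then -1 else 1) * y (if Suc j < l then Suc j else 0) +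
     (if j = 1 then -1 else 1) * y (if j = 0 then l - 1 else j - 1) = 0)"

lemma cell_kernel_3: "cell_kernel 3 y \<longleftrightarrow> y 0 = 0 \<and> y 1 = 0 \<and> y 2 = 0"
  by (auto simp: cell_kernel_def numeral_eq_Suc All_less_Suc)

lemma cell_kernel_4: "cell_kernel 4 y \<longleftrightarrow> y 0 = 0 \<and> y 1 = 0 \<and> y 2 = 0 \<and> y 3 = 0"
  by (auto simp: cell_kernel_def numeral_eq_Suc All_less_Suc)

text \<open>Each equation links two positions of equal parity. The three equations within a parity
  class are dependent, which leaves one free value per class, here \<open>y 0\<close> and
  \<open>y 1\<close>.\<close>

lemma cell_kernel_6:
  "cell_kernel 6 y \<longleftrightarrow> y 2 = y 0 \<and> y 3 = - y 1 \<and> y 4 = - y 0 \<and> y 5 = y 1"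
  by (auto simp: cell_kernel_def numeral_eq_Suc All_less_Suc)

text \<open>
  Cell \<open>i < c\<close> consists of the vertices \<open>6 i, \<dots>, 6 i + 5\<close>. Its first \<open>L i\<close> vertices form a cycle that
  is joined to the hub at \<open>6 i\<close>, and its other vertices are leaves at the hub, as are the \<open>k\<close>
  vertices after the hub. The negative edges are the \<open>{6 i, 6 i + 1}\<close>, one in each cycle.
\<close>
locale cycle_star =
  fixes c k :: nat and L :: "nat \<Rightarrow> nat"
  assumes L: "L i \<in> {3, 4, 6}" and k: "k \<ge> 1"
begin

abbreviation "hub \<equiv> 6 * c"
abbreviation "N \<equiv> Suc (6 * c + k)"

text \<open>A cell occupies six consecutive numbers whatever the length of its cycle, so
  \<open>v div 6\<close> is the cell and \<open>v mod 6\<close> the position in it.\<close>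

definition cyc :: "nat set" where
  "cyc = {v. v < 6 * c \<and> v mod 6 < L (v div 6)}"

definition nxt :: "nat \<Rightarrow> nat" where
  "nxt v = (if Suc (v mod 6) < L (v div 6) then Suc v else 6 * (v div 6))"

definition leaf :: "nat set" where
  "leaf = {..<N} - {hub} - cyc"

definition spoke :: "nat set" where
  "spoke = leaf \<union> (\<lambda>i. 6 * i) ` {..<c}"

text \<open>One orientation of every edge, around the cycles and towards the hub, so that edges can
  be counted as steps.\<close>

definition steps :: "(nat \<times> nat) set" where
  "steps = (\<lambda>v. (v, nxt v)) ` cyc \<union> (\<lambda>v. (v, hub)) ` spoke"

definition G :: "nat pair_pre_digraph" where
  "G = \<lparr>pverts = {..<N}, parcs = steps \<union> steps\<inverse>\<rparr>"

definition neg :: "nat set set" where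
  "neg = (\<lambda>i. {6 * i, Suc (6 * i)}) ` {..<c}"

definition sg :: "nat set \<Rightarrow> int" where
  "sg = restrict (\<lambda>e. if e \<in> neg then -1 else 1) (edges G)"

section \<open>Arithmetic of the cells and the successor along a cycle\<close>

lemma L_bounds: "3 \<le> L i" "L i \<le> 6"
  using L[of i] by auto

lemma cell_less: "i < c \<Longrightarrow> j < 6 \<Longrightarrow> 6 * i + j < 6 * c"
  by linarith

lemma mem_cyc_iff: "j < 6 \<Longrightarrow> 6 * i + j \<in> cyc \<longleftrightarrow> i < c \<and> j < L i"
  using cell_less[of i j] by (auto simp: cyc_def)

lemma cycE:
  assumes "v \<in> cyc"
  obtains i j where "v = 6 * i + j" "i < c" "j < L i" "j < 6"
proof (rule that)
  show "v = 6 * (v div 6) + v mod 6" by simp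
qed (use assms in \<open>auto simp: cyc_def\<close>)

lemma nxt_eq: "j < 6 \<Longrightarrow> nxt (6 * i + j) = 6 * i + (if Suc j < L i then Suc j else 0)"
  by (simp add: nxt_def)

lemma nxt_in_cyc:
  assumes "v \<in> cyc" shows "nxt v \<in> cyc"
proof -
  obtain i j where v: "v = 6 * i + j" "i < c" "j < L i" "j < 6" by (rule cycE[OF assms])
  have "(if Suc j < L i then Suc j else 0) < 6" using L_bounds(2)[of i] by auto
  moreover have "(if Suc j < L i then Suc j else 0) < L i" using v(3) by auto
  ultimately show ?thesis unfolding v(1) nxt_eq[OF v(4)] using v(2) by (subst mem_cyc_iff) blast+
qed

lemma cell_eq_iff: "j < 6 \<Longrightarrow> j' < 6 \<Longrightarrow> 6 * i + j = 6 * i' + j' \<longleftrightarrow> i = i' \<and> j = j'"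
  for i i' j j' :: nat
proof
  assume *: "j < 6" "j' < 6" "6 * i + j = 6 * i' + j'"
  show "i = i' \<and> j = j'"
    using arg_cong[OF *(3), of "\<lambda>n. n div 6"] arg_cong[OF *(3), of "\<lambda>n. n mod 6"] *(1,2) by simp
qed simp

lemma nxt_neq:
  assumes "v \<in> cyc" shows "nxt v \<noteq> v"
proof -
  obtain i j where v: "v = 6 * i + j" "j < L i" "j < 6" by (rule cycE[OF assms])
  thus ?thesis using L_bounds(1)[of i] by (auto simp: nxt_eq)
qed

text \<open>Cycles have length at least 3. This keeps opposite pairs out of
  \<open>steps\<close>.\<close>

lemma nxt_nxt_neq:
  assumes "v \<in> cyc" shows "nxt (nxt v) \<noteq> v"
proof -
  obtain i j where v: "v = 6 * i + j" "j < L i" "j < 6" by (rule cycE[OF assms])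
  show ?thesis
  proof (cases "Suc j < L i")
    case True
    thus ?thesis unfolding v(1) using v(3) L_bounds[of i] by (simp add: nxt_eq nxt_eq[of "Suc j", simplified])
  next
    case False
    thus ?thesis unfolding v(1) using v(2,3) L_bounds(1)[of i] by (simp add: nxt_eq nxt_eq[of 0, simplified])
  qed
qed

text \<open>Uniqueness of the predecessor on a cycle; it identifies the second cycle neighbour of a
  vertex in \<open>row_cell\<close>.\<close>

lemma inj_on_nxt: "inj_on nxt cyc"
proof (rule inj_onI)
  fix v v' assume *: "v \<in> cyc" "v' \<in> cyc" "nxt v = nxt v'"
  obtain i j where v: "v = 6 * i + j" "j < L i" "j < 6" by (rule cycE[OF *(1)])
  obtain i' j' where v': "v' = 6 * i' + j'" "j' < L i'" "j' < 6" by (rule cycE[OF *(2)])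
  have "(if Suc j < L i then Suc j else 0) < 6" "(if Suc j' < L i' then Suc j' else 0) < 6"
    using L_bounds(2)[of i] L_bounds(2)[of i'] by auto
  moreover have "6 * i + (if Suc j < L i then Suc j else 0) = 6 * i' + (if Suc j' < L i' then Suc j' else 0)"
    using *(3) v v' by (simp only: nxt_eq)
  ultimately have "i = i'" "(if Suc j < L i then Suc j else 0) = (if Suc j' < L i' then Suc j' else 0)"
    using cell_eq_iff by blast+
  thus "v = v'" using v v' by (auto split: if_splits)
qed

lemma cyc_less: "v \<in> cyc \<Longrightarrow> v < hub" and finite_cyc: "finite cyc"
  and spoke_less: "v \<in> spoke \<Longrightarrow> v < N" and spoke_neq: "v \<in> spoke \<Longrightarrow> v \<noteq> hub"
  and finite_leaf: "finite leaf" and finite_spoke: "finite spoke"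
  by (auto simp: cyc_def spoke_def leaf_def)

section \<open>The graph and its number of edges\<close>

lemma mem_steps_iff: "(u, v) \<in> steps \<longleftrightarrow> (u \<in> cyc \<and> v = nxt u) \<or> (u \<in> spoke \<and> v = hub)"
  by (auto simp: steps_def)

lemma steps_asym: "(u, v) \<in> steps \<Longrightarrow> (v, u) \<notin> steps"
  using cyc_less nxt_in_cyc nxt_nxt_neq spoke_neq by (fastforce simp: mem_steps_iff)

lemma finite_steps: "finite steps"
  by (simp add: steps_def finite_cyc finite_spoke)

lemma steps_verts: "(u, v) \<in> steps \<Longrightarrow> u < N \<and> v < N \<and> u \<noteq> v"
  using cyc_less nxt_in_cyc nxt_neq spoke_neq spoke_less by (fastforce simp: mem_steps_iff)

lemma pverts_G [simp]: "pverts G = {..<N}" and mem_parcs_iff: "(u, v) \<in> parcs G \<longleftrightarrow> (u, v) \<in> steps \<or> (v, u) \<in> steps"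
  by (auto simp: G_def)

lemma pair_graph_G: "pair_graph G"
proof
  show "finite (parcs G)" using finite_steps by (simp add: G_def)
  show "symmetric (with_proj G)"
    unfolding symmetric_def with_proj_simps by (auto intro!: symI simp: mem_parcs_iff)
qed (auto simp: mem_parcs_iff dest: steps_verts)

lemma edges_G: "edges G = (\<lambda>(u, v). {u, v}) ` steps"
  unfolding edges_def by (auto simp: mem_parcs_iff image_iff; metis insert_commute)

lemma inj_on_steps: "inj_on (\<lambda>(u, v). {u, v}) steps"
  by (rule inj_onI) (auto simp: doubleton_eq_iff dest: steps_asym)

lemma card_leaf: "card leaf + card cyc = 6 * c + k"
proof -
  have "cyc \<subseteq> {..<N} - {hub}" using cyc_less by fastforce
  hence "card leaf = card ({..<N} - {hub}) - card cyc" "card cyc \<le> card ({..<N} - {hub})"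
    unfolding leaf_def using finite_cyc by (rule_tac [2] card_mono, rule_tac card_Diff_subset) auto
  thus ?thesis by simp
qed

lemma card_spoke: "card spoke = card leaf + c"
proof -
  have "leaf \<inter> (\<lambda>i. 6 * i) ` {..<c} = {}"
  proof -
    have "6 * i \<in> cyc" if "i < c" for i
      using that L_bounds(1)[of i] mem_cyc_iff[of 0 i] by auto
    thus ?thesis by (auto simp: leaf_def)
  qed
  moreover have "inj_on (\<lambda>i::nat. 6 * i) {..<c}" by (auto intro: inj_onI)
  ultimately show ?thesis unfolding spoke_def
    by (simp add: card_Un_disjoint finite_leaf card_image)
qed

text \<open>Every vertex but the hub starts one step, around its cycle or from a leaf to the hub;
  the first vertex of each cycle starts a second one.\<close>

lemma card_edges: "card (edges G) = 6 * c + k + c"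
proof -
  have "card (edges G) = card steps" unfolding edges_G by (rule card_image[OF inj_on_steps])
  also have "\<dots> = card cyc + card spoke"
    unfolding steps_def using cyc_less nxt_in_cyc
    by (subst card_Un_disjoint)
      (force simp: finite_cyc finite_spoke card_image inj_on_def)+
  finally show ?thesis using card_spoke card_leaf by simp
qed

lemma card_cyc: "card cyc = (\<Sum>i<c. L i)"
proof -
  have "cyc = (\<Union>i<c. (\<lambda>j. 6 * i + j) ` {..<L i})"
    using L_bounds(2) mem_cyc_iff by (auto elim!: cycE) (meson order_less_le_trans)
  also have "card \<dots> = (\<Sum>i<c. card ((\<lambda>j. 6 * i + j) ` {..<L i}))"
  proof (rule card_UN_disjoint)
    show "\<forall>i\<in>{..<c}. \<forall>i'\<in>{..<c}. i \<noteq> i' \<longrightarrow> (\<lambda>j. 6 * i + j) ` {..<L i} \<inter> (\<lambda>j. 6 * i' + j) ` {..<L i'} = {}"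
      using L_bounds(2) by (auto simp: cell_eq_iff order_less_le_trans)
  qed auto
  also have "\<dots> = (\<Sum>i<c. L i)" by (simp add: card_image inj_on_def)
  finally show ?thesis .
qed

section \<open>Connectedness and the cyclomatic number\<close>

lemma reachable_hub: "v < N \<Longrightarrow> (v, hub) \<in> rtrancl_on {..<N} (parcs G)"
proof (induction v rule: less_induct)
  case (less v)
  have base: ?case if "v \<in> spoke"
  proof -
    have "(v, hub) \<in> parcs G" using that by (simp add: mem_parcs_iff mem_steps_iff)
    thus ?thesis using less.prems by (auto intro!: rtrancl_on_into_rtrancl_on[where b = v])
  qed
  consider "v = hub" | "v \<in> spoke" | "v \<in> cyc" "v \<notin> spoke" using less.prems by (auto simp: spoke_def leaf_def)
  thus ?case
  proof cases
    case 3
    obtain i j where v: "v = 6 * i + j" "i < c" "j < L i" "j < 6" by (rule cycE[OF 3(1)])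
    with 3 have "j \<noteq> 0" by (auto simp: spoke_def)
    \<comment> \<open>A cycle vertex walks back towards the first vertex of its cell, which is
      adjacent to the hub; the vertex number decreases on the way.\<close>
    then obtain j' where j': "j = Suc j'" by (cases j) auto
    have "(6 * i + j', v) \<in> steps" using v j' by (auto simp: mem_steps_iff mem_cyc_iff nxt_eq)
    hence "(v, 6 * i + j') \<in> parcs G" by (simp add: mem_parcs_iff)
    moreover have "(6 * i + j', hub) \<in> rtrancl_on {..<N} (parcs G)" using less v j' by auto
    ultimately show ?thesis using less.prems by (meson converse_rtrancl_on_into_rtrancl_on lessThan_iff)
  qed (use base in auto)
qed

lemma strongly_connected_G: "strongly_connected (with_proj G)"
proof -
  interpret pair_graph G by (rule pair_graph_G)
  have *: "v \<rightarrow>\<^sup>*\<^bsub>with_proj G\<^esub> hub" if "v < N" for v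
    using reachable_hub[OF that] by (simp add: reachable_def)
  show ?thesis
    by (rule strongly_connectedI) (auto intro: * symmetric_reachable' reachable_trans[OF *])
qed

lemma connected_G: "Digraph_Component.connected (with_proj G)"
proof -
  interpret pair_graph G by (rule pair_graph_G)
  show ?thesis using strongly_connected_G reachable_mk_symmetricI
    by (auto simp: connected_def strongly_connected_def)
qed

text \<open>There are \<open>7 c + k\<close> edges, \<open>6 c + k + 1\<close> vertices and one
  component.\<close>

lemma cyclomatic_number_G: "cyclomatic_number G = int c"
proof -
  interpret pair_graph G by (rule pair_graph_G)
  show ?thesis
    by (simp add: cyclomatic_number_def card_edges
      num_components_strongly_connected[OF wf_digraph_axioms strongly_connected_G])
qed

section \<open>Signs of the edges\<close>

lemma signed_graph_G: "signed_graph G sg"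
  using pair_graph_G by (auto simp: signed_graph_def sg_def)

lemma steps_cell: "i < c \<Longrightarrow> j < L i \<Longrightarrow> (6 * i + j, 6 * i + (if Suc j < L i then Suc j else 0)) \<in> steps"
  using L_bounds(2)[of i] by (simp add: mem_steps_iff mem_cyc_iff nxt_eq)

lemma sg_steps: "(u, v) \<in> steps \<Longrightarrow> sg {u, v} = (if {u, v} \<in> neg then -1 else 1)"
  by (force simp: sg_def edges_G)

lemma sg_spoke:
  assumes "v \<in> spoke" shows "sg {v, hub} = 1"
proof -
  have "{v, hub} \<notin> neg" by (auto simp: neg_def doubleton_eq_iff)
  thus ?thesis using assms by (simp add: sg_steps mem_steps_iff)
qed

lemma sg_cell:
  assumes "i < c" "j < L i"
  shows "sg {6 * i + j, 6 * i + (if Suc j < L i then Suc j else 0)} = (if j = 0 then -1 else 1)"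
proof -
  let ?j = "if Suc j < L i then Suc j else 0"
  have *: "j < 6" "?j < 6" using assms L_bounds(2)[of i] by auto
  have eq: "{6 * i + j, 6 * i + ?j} = {6 * i' + 0, 6 * i' + 1} \<longleftrightarrow> i = i' \<and> j = 0" for i'
  proof -
    have "(0::nat) < 6" "(1::nat) < 6" by simp_all
    note eqs = cell_eq_iff[OF *(1) this(1)] cell_eq_iff[OF *(1) this(2)]
      cell_eq_iff[OF *(2) this(1)] cell_eq_iff[OF *(2) this(2)]
    \<comment> \<open>As the length is at least 3, the step out of position 1 leads to 2, so only
      the step out of 0 gives the pair of positions 0 and 1.\<close>
    have "j = 0 \<Longrightarrow> ?j = 1" "j = 1 \<Longrightarrow> ?j \<noteq> 0" using L_bounds(1)[of i] by auto
    thus ?thesis unfolding doubleton_eq_iff eqs by blast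
  qed
  have "e \<in> neg \<longleftrightarrow> (\<exists>i'<c. e = {6 * i' + 0, 6 * i' + 1})" for e unfolding neg_def by auto
  hence "{6 * i + j, 6 * i + ?j} \<in> neg \<longleftrightarrow> (\<exists>i'<c. i = i' \<and> j = 0)" by (simp only: eq)
  also have "\<dots> \<longleftrightarrow> j = 0" using assms(1) by blast
  finally show ?thesis using assms by (simp only: sg_steps[OF steps_cell])
qed

section \<open>Rows of the adjacency matrix\<close>

lemma adjacency_mat_G:
  "adjacency_mat G sg = mat N N (\<lambda>(u, v). if (u, v) \<in> parcs G then of_int (sg {u, v}) else 0)"
  unfolding adjacency_mat_def Let_def
  by (intro eq_matI) (auto simp: sorted_list_of_set_lessThan_Suc lessThan_atLeast0 simp del: sorted_list_of_set_lessThan_Suc upt_Suc)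

lemma adjacency_mat_carrier: "adjacency_mat G sg \<in> carrier_mat N N"
  by (simp add: adjacency_mat_G)

lemma adjacency_mat_sym: "transpose_mat (adjacency_mat G sg) = adjacency_mat G sg"
  unfolding adjacency_mat_G by (rule eq_matI) (auto simp: mem_parcs_iff insert_commute)

text \<open>Neighbours where \<open>x\<close> vanishes may be left out of \<open>B\<close>; this
  removes the hub from the row of the first vertex of a cycle.\<close>

lemma row_sum:
  assumes "x \<in> carrier_vec N" "u < N" "\<And>v. (u, v) \<in> parcs G \<Longrightarrow> v \<in> B \<or> x $ v = 0"
    "B \<subseteq> {v. (u, v) \<in> parcs G}"
  shows "(adjacency_mat G sg *\<^sub>v x) $ u = (\<Sum>v\<in>B. of_int (sg {u, v}) * x $ v)"
proof -
  have "B \<subseteq> {..<N}" using assms(4) by (auto simp: mem_parcs_iff dest: steps_verts)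
  have "(adjacency_mat G sg *\<^sub>v x) $ u
      = (\<Sum>v<N. if (u, v) \<in> parcs G then of_int (sg {u, v}) * x $ v else 0)"
    using assms(1,2) by (auto simp: adjacency_mat_G scalar_prod_def atLeast0LessThan intro!: sum.cong)
  also have "\<dots> = (\<Sum>v\<in>B. of_int (sg {u, v}) * x $ v)"
    using assms(3,4) \<open>B \<subseteq> {..<N}\<close> by (intro sum.mono_neutral_cong_right) (auto simp del: lessThan_Suc)
  finally show ?thesis .
qed

lemma row_hub:
  assumes "x \<in> carrier_vec N"
  shows "(adjacency_mat G sg *\<^sub>v x) $ hub = (\<Sum>v\<in>spoke. x $ v)"
proof -
  have "(hub, v) \<in> parcs G \<longleftrightarrow> v \<in> spoke" for v
    using cyc_less spoke_neq nxt_in_cyc by (fastforce simp: mem_parcs_iff mem_steps_iff)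
  hence "(adjacency_mat G sg *\<^sub>v x) $ hub = (\<Sum>v\<in>spoke. of_int (sg {hub, v}) * x $ v)"
    using assms by (intro row_sum) auto
  thus ?thesis by (simp add: insert_commute[of hub] sg_spoke)
qed

lemma row_leaf:
  assumes "x \<in> carrier_vec N" "u \<in> leaf"
  shows "(adjacency_mat G sg *\<^sub>v x) $ u = x $ hub"
proof -
  have u: "u \<in> spoke" "u < N" "u \<noteq> hub" "u \<notin> cyc" using assms(2) by (auto simp: spoke_def leaf_def)
  hence "(u, v) \<in> parcs G \<longleftrightarrow> v = hub" for v
    using nxt_in_cyc by (auto simp: mem_parcs_iff mem_steps_iff)
  hence "(adjacency_mat G sg *\<^sub>v x) $ u = (\<Sum>v\<in>{hub}. of_int (sg {u, v}) * x $ v)"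
    using assms u by (intro row_sum) auto
  thus ?thesis using u by (simp add: sg_spoke)
qed

text \<open>Once \<open>x\<close> vanishes at the hub, a cycle vertex sees only its cycle, and its
  row is an equation of \<open>cell_kernel\<close>.\<close>

lemma row_cell:
  assumes "x \<in> carrier_vec N" "x $ hub = 0" "i < c" "j < L i"
  shows "(adjacency_mat G sg *\<^sub>v x) $ (6 * i + j) =
     (if j = 0 then -1 else 1) * x $ (6 * i + (if Suc j < L i then Suc j else 0)) +
     (if j = 1 then -1 else 1) * x $ (6 * i + (if j = 0 then L i - 1 else j - 1))"
proof -
  define p where "p = (if j = 0 then L i - 1 else j - 1)"
  define q where "q = (if Suc j < L i then Suc j else 0)"
  note L3 = L_bounds(1)[of i] and L6 = L_bounds(2)[of i]
  \<comment> \<open>Length at least 3 makes the two cycle neighbours distinct. The edge from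
    \<open>p\<close> is negative exactly when \<open>p = 0\<close>, that is, when
    \<open>j = 1\<close>.\<close>
  have p: "p < L i" "(if Suc p < L i then Suc p else 0) = j" "p \<noteq> q" "p = 0 \<longleftrightarrow> j = 1"
    using L3 assms(4) by (auto simp: p_def q_def)
  have out: "(6 * i + j, 6 * i + q) \<in> steps" using steps_cell assms by (simp add: q_def)
  have inn: "(6 * i + p, 6 * i + j) \<in> steps" using steps_cell[OF assms(3) p(1)] by (simp only: p(2))
  have cyc: "6 * i + j \<in> cyc" "6 * i + p \<in> cyc" using assms p(1) L6 by (auto simp: mem_cyc_iff)
  have "(adjacency_mat G sg *\<^sub>v x) $ (6 * i + j) =
      (\<Sum>v\<in>{6 * i + q, 6 * i + p}. of_int (sg {6 * i + j, v}) * x $ v)"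
  proof (rule row_sum[OF assms(1)])
    show "6 * i + j < N" using out steps_verts by blast
    show "{6 * i + q, 6 * i + p} \<subseteq> {v. (6 * i + j, v) \<in> parcs G}"
      using out inn by (auto simp: mem_parcs_iff)
    fix v assume "(6 * i + j, v) \<in> parcs G"
    then consider "(6 * i + j, v) \<in> steps" | "(v, 6 * i + j) \<in> steps" by (auto simp: mem_parcs_iff)
    thus "v \<in> {6 * i + q, 6 * i + p} \<or> x $ v = 0"
    proof cases
      case 1
      moreover have "nxt (6 * i + j) = 6 * i + q"
        using assms(4) L6 by (simp add: nxt_eq q_def)
      ultimately show ?thesis using assms(2) by (auto simp: mem_steps_iff)
    next
      case 2
      hence "v \<in> cyc" "nxt v = nxt (6 * i + p)"
        using inn cyc cyc_less[OF cyc(1)] by (auto simp: mem_steps_iff)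
      hence "v = 6 * i + p" using inj_on_nxt cyc(2) by (auto dest: inj_onD)
      thus ?thesis by simp
    qed
  qed
  moreover have "sg {6 * i + j, 6 * i + q} = (if j = 0 then -1 else 1)"
    using sg_cell[OF assms(3,4)] by (simp add: q_def)
  moreover have "sg {6 * i + j, 6 * i + p} = (if j = 1 then -1 else 1)"
    using sg_cell[OF assms(3) p(1)] unfolding p(2) by (simp add: p(4) insert_commute)
  ultimately show ?thesis using p(3) unfolding p_def[symmetric] q_def[symmetric] by simp
qed

section \<open>The kernel and the nullity\<close>

lemma Suc_hub_leaf: "Suc hub \<in> leaf"
  using k cyc_less[of "Suc hub"] by (auto simp: leaf_def)

text \<open>The row of the leaf \<open>Suc hub\<close>, which exists because
  \<open>k \<ge> 1\<close>, gives \<open>x $ hub = 0\<close>. The cycles then decouple, and the row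
  of the hub is the only other condition.\<close>

lemma kernel_iff:
  assumes "x \<in> carrier_vec N"
  shows "adjacency_mat G sg *\<^sub>v x = 0\<^sub>v N \<longleftrightarrow>
    x $ hub = 0 \<and> (\<Sum>v\<in>spoke. x $ v) = 0 \<and> (\<forall>i<c. cell_kernel (L i) (\<lambda>j. x $ (6 * i + j)))"
    (is "_ \<longleftrightarrow> ?R")
proof -
  let ?A = "adjacency_mat G sg"
  have cell: "cell_kernel (L i) (\<lambda>j. x $ (6 * i + j)) \<longleftrightarrow> (\<forall>j<L i. (?A *\<^sub>v x) $ (6 * i + j) = 0)"
    if "x $ hub = 0" "i < c" for i
    unfolding cell_kernel_def using row_cell[OF assms that] by simp
  have "?A *\<^sub>v x = 0\<^sub>v N \<longleftrightarrow> (\<forall>u<N. (?A *\<^sub>v x) $ u = 0)"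
  proof -
    have "dim_vec (?A *\<^sub>v x) = N" using adjacency_mat_carrier by auto
    thus ?thesis by (auto simp del: index_mult_mat_vec intro!: eq_vecI)
  qed
  also have "\<dots> \<longleftrightarrow> ?R"
  proof
    assume *: "\<forall>u<N. (?A *\<^sub>v x) $ u = 0"
    hence hub: "x $ hub = 0" using row_leaf[OF assms Suc_hub_leaf] k by simp
    moreover have "(\<Sum>v\<in>spoke. x $ v) = 0" using * row_hub[OF assms] by simp
    moreover have "cell_kernel (L i) (\<lambda>j. x $ (6 * i + j))" if "i < c" for i
      unfolding cell[OF hub that] using * that steps_cell steps_verts by blast
    ultimately show ?R by blast
  next
    assume R: ?R
    show "\<forall>u<N. (?A *\<^sub>v x) $ u = 0"
    proof (intro allI impI)
      fix u assume "u < N"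
      then consider "u = hub" | "u \<in> leaf" | "u \<in> cyc" by (auto simp: leaf_def)
      thus "(?A *\<^sub>v x) $ u = 0"
      proof cases
        case 3
        then obtain i j where "u = 6 * i + j" "i < c" "j < L i" "j < 6" by (rule cycE)
        thus ?thesis using R cell by auto
      qed (use R in \<open>auto simp: row_hub[OF assms] row_leaf[OF assms]\<close>)
    qed
  qed
  finally show ?thesis .
qed

text \<open>
  Coordinates that parametrise the kernel: the values at the leaves are arbitrary except that the
  hub equation determines the one at \<open>Suc hub\<close>, and a hexagon contributes two free values.
\<close>
definition free :: "nat set" where
  "free = (leaf - {Suc hub}) \<union> (\<lambda>(i, j). 6 * i + j) ` ({i. i < c \<and> L i = 6} \<times> {..<2})"

lemma card_free: "card free + 1 = card leaf + 2 * card {i. i < c \<and> L i = 6}"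
proof -
  let ?B = "(\<lambda>(i, j). 6 * i + j) ` ({i. i < c \<and> L i = 6} \<times> {..<2})"
  have "?B \<subseteq> cyc" by (auto simp: mem_cyc_iff)
  hence "(leaf - {Suc hub}) \<inter> ?B = {}" by (auto simp: leaf_def)
  hence "card free = card (leaf - {Suc hub}) + card ?B"
    unfolding free_def by (intro card_Un_disjoint) (auto simp: finite_leaf)
  moreover have "card ?B = 2 * card {i. i < c \<and> L i = 6}"
    by (subst card_image) (auto simp: inj_on_def card_cartesian_product cell_eq_iff)
  moreover have "card leaf = Suc (card (leaf - {Suc hub}))"
    using Suc_hub_leaf finite_leaf by (metis card.remove)
  ultimately show ?thesis by simp
qed

text \<open>Triangles and squares have trivial kernel, and the first two values on a hexagon, which
  lie in \<open>free\<close>, determine the rest. Only the value at \<open>Suc hub\<close> remains,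
  and the hub equation makes it 0.\<close>

lemma kernel_free_zero:
  assumes x: "x \<in> carrier_vec N" and "adjacency_mat G sg *\<^sub>v x = 0\<^sub>v N" and F: "\<forall>v\<in>free. x $ v = 0"
  shows "x = 0\<^sub>v N"
proof -
  have hub: "x $ hub = 0" and sum: "(\<Sum>v\<in>spoke. x $ v) = 0"
    and cell: "\<And>i. i < c \<Longrightarrow> cell_kernel (L i) (\<lambda>j. x $ (6 * i + j))"
    using assms(2) kernel_iff[OF x] by auto
  have cyc: "x $ v = 0" if v: "v \<in> cyc" for v
  proof -
    obtain i j where ij: "v = 6 * i + j" "i < c" "j < L i" by (rule cycE[OF v])
    note cell = cell[OF ij(2)]
    consider "L i = 3" | "L i = 4" | "L i = 6" using L[of i] by auto
    thus ?thesis
    proof cases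
      case 1
      hence "j = 0 \<or> j = 1 \<or> j = 2" using ij(3) by linarith
      thus ?thesis using 1 cell ij(1) by (auto simp: cell_kernel_3)
    next
      case 2
      hence "j = 0 \<or> j = 1 \<or> j = 2 \<or> j = 3" using ij(3) by linarith
      thus ?thesis using 2 cell ij(1) by (auto simp: cell_kernel_4)
    next
      case 3
      have "(\<lambda>(i, j). 6 * i + j) (i, t) \<in> free" if "t < 2" for t
        unfolding free_def using 3 ij(2) that by (intro UnI2 imageI) auto
      from this[of 0] this[of 1] have "x $ (6 * i) = 0" "x $ (6 * i + 1) = 0" using F by auto
      moreover have "j = 0 \<or> j = 1 \<or> j = 2 \<or> j = 3 \<or> j = 4 \<or> j = 5" using 3 ij(3) by linarith
      ultimately show ?thesis using 3 cell ij(1) by (auto simp: cell_kernel_6)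
    qed
  qed
  have rest: "x $ v = 0" if "v < N" "v \<noteq> Suc hub" for v
    using that hub cyc F by (cases "v \<in> cyc \<or> v = hub") (auto simp: free_def leaf_def)
  have "(\<Sum>v\<in>spoke. x $ v) = x $ Suc hub + (\<Sum>v\<in>spoke - {Suc hub}. x $ v)"
    using Suc_hub_leaf finite_spoke by (simp add: sum.remove spoke_def)
  also have "(\<Sum>v\<in>spoke - {Suc hub}. x $ v) = 0"
    using rest spoke_less by (intro sum.neutral) blast
  finally have "x $ Suc hub = 0" using sum by simp
  with rest show ?thesis using x by (intro eq_vecI) auto
qed

lemma kernel_free_extend:
  "\<exists>x\<in>carrier_vec N. adjacency_mat G sg *\<^sub>v x = 0\<^sub>v N \<and> (\<forall>v\<in>free. x $ v = g v)"
proof -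
  \<comment> \<open>The list \<open>[a, b, a, -b, -a, b]\<close> is the general solution in
    \<open>cell_kernel_6\<close>.\<close>
  define h where "h v = (if v \<in> leaf then g v else if v \<in> cyc \<and> L (v div 6) = 6
    then let a = g (6 * (v div 6)); b = g (6 * (v div 6) + 1) in [a, b, a, -b, -a, b] ! (v mod 6)
    else 0)" for v
  \<comment> \<open>The value at \<open>Suc hub\<close> is chosen to solve the hub equation.\<close>
  define x where "x = vec N (\<lambda>v. if v = Suc hub then - (\<Sum>u\<in>spoke - {Suc hub}. h u) else h v)"
  have x: "x \<in> carrier_vec N" by (simp add: x_def)
  have xh: "x $ v = h v" if "v < N" "v \<noteq> Suc hub" for v using that by (simp add: x_def)
  have cell: "x $ (6 * i + j) = (if L i = 6
      then [g (6 * i), g (6 * i + 1), g (6 * i), - g (6 * i + 1), - g (6 * i), g (6 * i + 1)] ! j else 0)"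
    if "i < c" "j < L i" for i j
  proof -
    have j: "j < 6" using that L_bounds(2)[of i] by auto
    hence "6 * i + j \<in> cyc" using that by (simp add: mem_cyc_iff)
    moreover have "6 * i + j < hub" using cyc_less calculation by blast
    ultimately show ?thesis using j by (subst xh) (auto simp: h_def leaf_def Let_def)
  qed
  have "x $ hub = 0" using cyc_less by (subst xh) (auto simp: h_def leaf_def)
  moreover have "(\<Sum>v\<in>spoke. x $ v) = 0"
  proof -
    have "(\<Sum>v\<in>spoke. x $ v) = x $ Suc hub + (\<Sum>v\<in>spoke - {Suc hub}. x $ v)"
      using Suc_hub_leaf finite_spoke by (simp add: sum.remove spoke_def)
    also have "(\<Sum>v\<in>spoke - {Suc hub}. x $ v) = (\<Sum>v\<in>spoke - {Suc hub}. h v)"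
      using spoke_less xh by (intro sum.cong) auto
    finally show ?thesis using k by (simp add: x_def)
  qed
  moreover have "cell_kernel (L i) (\<lambda>j. x $ (6 * i + j))" if "i < c" for i
  proof -
    note cell' = cell[OF that]
    consider "L i = 3" | "L i = 4" | "L i = 6" using L[of i] by auto
    thus ?thesis
    proof cases
      case 1 thus ?thesis using cell'[of 0] cell'[of 1] cell'[of 2] by (simp add: cell_kernel_3)
    next
      case 2 thus ?thesis using cell'[of 0] cell'[of 1] cell'[of 2] cell'[of 3]
        by (simp add: cell_kernel_4)
    next
      case 3 thus ?thesis using cell'[of 0] cell'[of 1] cell'[of 2] cell'[of 3] cell'[of 4] cell'[of 5]
        by (simp add: cell_kernel_6)
    qed
  qed
  moreover have "x $ v = g v" if "v \<in> free" for v
  proof (cases "v \<in> leaf")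
    case True
    moreover have "v \<noteq> Suc hub" using that True cyc_less[of "Suc hub"] by (auto simp: free_def mem_cyc_iff leaf_def)
    ultimately show ?thesis by (subst xh) (auto simp: h_def leaf_def)
  next
    case False
    with that obtain i j where "v = 6 * i + j" "i < c" "L i = 6" "j < 2" by (auto simp: free_def)
    moreover from this have "j = 0 \<or> j = 1" by linarith
    ultimately show ?thesis using cell[of i j] by auto
  qed
  ultimately show ?thesis using kernel_iff[OF x] x by blast
qed

text \<open>Extending the indicator of each point of \<open>free\<close> yields the dual kernel
  basis required by \<open>order_char_poly_symmetric\<close>.\<close>

lemma nullity_G: "nullity G sg = card free"
  unfolding nullity_def
proof (rule order_char_poly_symmetric[OF adjacency_mat_carrier adjacency_mat_sym _ _ kernel_free_zero])
  show "free \<subseteq> {..<N}"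
    using cyc_less by (fastforce simp: free_def leaf_def)
qed (use kernel_free_extend in auto)

section \<open>The matching number\<close>

lemma matching_number_G: "matching_number G = 1 + (\<Sum>i<c. L i div 2)"
proof -
  have fin: "finite {M. matching G M}"
    by (rule finite_subset[of _ "Pow (edges G)"]) (auto simp: matching_def edges_G finite_steps)
  have upper: "card M \<le> 1 + (\<Sum>i<c. L i div 2)" if M: "matching G M" for M
  proof -
    \<comment> \<open>At most one matching edge meets the hub. Any other lies within a single cycle,
      which holds at most \<open>L i div 2\<close> of them.\<close>
    define H where "H = {e \<in> M. hub \<in> e}"
    define C where "C i = {e \<in> M. e \<subseteq> (\<lambda>j. 6 * i + j) ` {..<L i}}" for i
    have fM: "finite M" using M finite_subset[of M "edges G"] by (auto simp: matching_def edges_G finite_steps)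
    have dM: "disjoint M" using M by (simp add: matching_def)
    have edge: "card e = 2 \<and> (hub \<in> e \<or> (\<exists>i<c. e \<subseteq> (\<lambda>j. 6 * i + j) ` {..<L i}))" if "e \<in> M" for e
    proof -
      have "e \<in> (\<lambda>(u, v). {u, v}) ` steps" using that M by (auto simp: matching_def edges_G)
      then obtain u v where e: "e = {u, v}" "(u, v) \<in> steps" by auto
      have "\<exists>i<c. e \<subseteq> (\<lambda>j. 6 * i + j) ` {..<L i}" if uv: "u \<in> cyc" "v = nxt u"
      proof -
        obtain i j where u: "u = 6 * i + j" "i < c" "j < L i" "j < 6" by (rule cycE[OF uv(1)])
        show ?thesis using u L_bounds(1)[of i] by (intro exI[of _ i]) (auto simp: e uv nxt_eq image_iff)
      qed
      thus ?thesis using e steps_verts[OF e(2)] by (auto simp: mem_steps_iff)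
    qed
    have card_H: "card H \<le> 1"
    proof -
      have "e = e'" if "e \<in> H" "e' \<in> H" for e e'
        using that dM by (auto simp: H_def disjoint_def)
      thus ?thesis using fM by (simp add: H_def card_le_Suc0_iff_eq)
    qed
    have card_C: "card (C i) \<le> L i div 2" for i
    proof -
      have "2 * card (C i) \<le> card ((\<lambda>j. 6 * i + j) ` {..<L i})"
        using edge dM by (intro card_matching_le) (auto simp: C_def disjoint_def)
      thus ?thesis by (simp add: card_image)
    qed
    have "M \<subseteq> H \<union> (\<Union>i<c. C i)" using edge by (auto simp: H_def C_def)
    hence "card M \<le> card (H \<union> (\<Union>i<c. C i))" using fM by (intro card_mono) (auto simp: H_def C_def)
    also have "\<dots> \<le> card H + card (\<Union>i<c. C i)" by (rule card_Un_le)
    also have "\<dots> \<le> card H + (\<Sum>i<c. card (C i))" by (simp add: card_UN_le)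
    also have "\<dots> \<le> 1 + (\<Sum>i<c. L i div 2)" by (intro add_mono sum_mono card_H card_C)
    finally show ?thesis .
  qed
  \<comment> \<open>The bound is attained by joining the hub to the leaf \<open>Suc hub\<close> and
    taking alternate edges along each cycle.\<close>
  define I where "I = (SIGMA i:{..<c}. {..<L i div 2})"
  define m where "m = (\<lambda>(i, t). {6 * i + 2 * t, 6 * i + Suc (2 * t)})"
  define M where "M = insert {Suc hub, hub} (m ` I)"
  have small: "i < c \<and> 2 * t < 6 \<and> Suc (2 * t) < 6 \<and> Suc (2 * t) < L i" if "(i, t) \<in> I" for i t
    using that L_bounds(2)[of i] by (auto simp: I_def)
  have dis: "m p \<inter> m q = {}" if pq: "p \<in> I" "q \<in> I" "p \<noteq> q" for p q
  proof -
    obtain i t i' t' where *: "p = (i, t)" "q = (i', t')" by fastforce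
    have b: "2 * t < 6" "Suc (2 * t) < 6" "2 * t' < 6" "Suc (2 * t') < 6"
      using small[of i t] small[of i' t'] pq(1,2) unfolding * by blast+
    have "2 * t \<noteq> Suc (2 * t')" "2 * t' \<noteq> Suc (2 * t)" by presburger+
    moreover have "i \<noteq> i' \<or> t \<noteq> t'" using pq(3) * by simp
    ultimately show ?thesis
      using cell_eq_iff[OF b(1,3), of i i'] cell_eq_iff[OF b(1,4), of i i']
        cell_eq_iff[OF b(2,3), of i i'] cell_eq_iff[OF b(2,4), of i i']
      by (auto simp: m_def *)
  qed
  have hub_m: "{Suc hub, hub} \<inter> m p = {}" if "p \<in> I" for p
    using that small[of "fst p" "snd p"] by (cases p) (auto simp: m_def)
  have nonempty: "m p \<noteq> {}" for p by (cases p) (simp add: m_def)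
  \<comment> \<open>Distinct indices give disjoint nonempty edges, which are therefore
    different.\<close>
  have "inj_on m I" using dis nonempty by (intro inj_onI) (metis inf.idem)
  hence "card M = 1 + card I"
    unfolding M_def using hub_m
    by (subst card_insert_disjoint) (auto simp: card_image I_def)
  hence card_M: "card M = 1 + (\<Sum>i<c. L i div 2)" by (simp add: I_def)
  have "m p \<in> edges G" if "p \<in> I" for p
    using that small[of "fst p" "snd p"] steps_cell[of "fst p" "2 * snd p"]
    by (cases p) (force simp: m_def edges_G)
  moreover have "{Suc hub, hub} \<in> edges G"
    using Suc_hub_leaf by (force simp: edges_G mem_steps_iff spoke_def)
  moreover have "disjoint M"
    unfolding M_def disjoint_def using dis hub_m by (auto; blast)
  ultimately have "matching G M" by (auto simp: matching_def M_def)
  thus ?thesis unfolding matching_number_def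
    using fin upper card_M by (intro Max_eqI) (auto simp: image_iff intro: exI[of _ M])
qed

section \<open>The nullity formula and unbalancedness\<close>

lemma nullity_formula:
  "int (nullity G sg) = int (card (pverts G)) - 2 * int (matching_number G)
     + 2 * cyclomatic_number G - int (\<Sum>i<c. defect (L i))"
proof -
  \<comment> \<open>The whole formula reduces to this identity for a single cycle, checked for the
    lengths 3, 4 and 6 and then summed over the cells.\<close>
  have "int (L i) - 2 * of_bool (L i = 6) = 2 * int (L i div 2) - 2 + int (defect (L i))" for i
    using L[of i] by (auto simp: defect_def)
  hence "(\<Sum>i<c. int (L i) - 2 * of_bool (L i = 6)) = (\<Sum>i<c. 2 * int (L i div 2) - 2 + int (defect (L i)))"
    by simp
  moreover have "(\<Sum>i<c. of_bool (L i = 6) :: int) = int (card {i. i < c \<and> L i = 6})"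
    by (simp add: of_bool_def sum.If_cases Int_def)
  ultimately have "int (card cyc) - 2 * int (card {i. i < c \<and> L i = 6})
      = 2 * (\<Sum>i<c. int (L i div 2)) - 2 * int c + (\<Sum>i<c. int (defect (L i)))"
    by (simp add: card_cyc sum.distrib sum_subtractf flip: sum_distrib_left)
  thus ?thesis using card_free card_leaf
    by (simp add: nullity_G matching_number_G cyclomatic_number_G)
qed

text \<open>The cycle of cell 0, present because \<open>c \<ge> 1\<close>, has exactly one negative
  edge, \<open>{0, 1}\<close>.\<close>

lemma unbalanced_G:
  assumes "c \<ge> 1" shows "\<not> balanced G sg"
proof -
  interpret pair_graph G by (rule pair_graph_G)
  have st: "(j, if Suc j < L 0 then Suc j else 0) \<in> steps" if "j < L 0" for j
    using steps_cell[of 0 j] assms that by simp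
  have sg: "sg {j, if Suc j < L 0 then Suc j else 0} = (if j = 0 then -1 else 1)" if "j < L 0" for j
    using sg_cell[of 0 j] assms that by simp
  have "\<exists>p. graph_cycle G p \<and> cycle_sign sg p = -1"
  proof -
    consider "L 0 = 3" | "L 0 = 4" | "L 0 = 6" using L[of 0] by auto
    thus ?thesis
    proof cases
      case 1
      thus ?thesis using st[of 0] st[of 1] st[of 2] sg[of 0] sg[of 1] sg[of 2]
        by (intro exI[of _ "[(0,1),(1,2),(2,0)]"])
          (auto simp: graph_cycle_def cycle_def awalk_def cycle_sign_def mem_parcs_iff numeral_eq_Suc intro!: exI[of _ 0])
    next
      case 2
      thus ?thesis using st[of 0] st[of 1] st[of 2] st[of 3] sg[of 0] sg[of 1] sg[of 2] sg[of 3]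
        by (intro exI[of _ "[(0,1),(1,2),(2,3),(3,0)]"])
          (auto simp: graph_cycle_def cycle_def awalk_def cycle_sign_def mem_parcs_iff numeral_eq_Suc intro!: exI[of _ 0])
    next
      case 3
      thus ?thesis using st[of 0] st[of 1] st[of 2] st[of 3] st[of 4] st[of 5]
          sg[of 0] sg[of 1] sg[of 2] sg[of 3] sg[of 4] sg[of 5]
        by (intro exI[of _ "[(0,1),(1,2),(2,3),(3,4),(4,5),(5,0)]"])
          (auto simp: graph_cycle_def cycle_def awalk_def cycle_sign_def mem_parcs_iff numeral_eq_Suc intro!: exI[of _ 0])
    qed
  qed
  thus ?thesis by (auto simp: balanced_def)
qed

end

section \<open>Choice of the cycle lengths\<close>

lemma exists_cycle_lengths:
  assumes "s \<le> 3 * c" "s \<noteq> 1"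
  shows "\<exists>L. (\<forall>i. L i \<in> {3, 4, 6}) \<and> (\<Sum>i<c. defect (L i)) = s"
  using assms
proof (induction c arbitrary: s)
  case 0
  thus ?case by (intro exI[of _ "\<lambda>_. 3"]) simp
next
  case (Suc c)
  have step: ?case if l: "l \<in> {3, 4, 6}" "defect l \<le> s"
    "s - defect l \<le> 3 * c" "s - defect l \<noteq> 1" for l
  proof -
    obtain L where "\<forall>i. L i \<in> {3, 4, 6}" "(\<Sum>i<c. defect (L i)) = s - defect l"
      using Suc.IH[OF l(3,4)] by blast
    with l show ?thesis by (intro exI[of _ "L(c := l)"]) simp
  qed
  \<comment> \<open>A triangle is taken whenever \<open>s \<ge> 3\<close>, except for
    \<open>s = 4\<close>, where it would leave the forbidden remainder 1; a square leaves 2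
    instead.\<close>
  consider "s = 0" | "s = 2" | "s = 4" | "s \<ge> 3" "s \<noteq> 4" using Suc.prems by linarith
  thus ?case
  proof cases
    case 1 thus ?thesis using step[of 6] by (simp add: defect_def)
  next
    case 2 thus ?thesis using step[of 4] by (simp add: defect_def)
  next
    case 3 thus ?thesis using step[of 4] Suc.prems by (simp add: defect_def)
  next
    case 4 thus ?thesis using step[of 3] Suc.prems by (simp add: defect_def)
  qed
qed

section \<open>The infinite family\<close>

theorem theorem1p3:
  fixes c s :: int
  assumes "c \<ge> 1" and "0 \<le> s" and "s \<le> 3 * c" and "s \<noteq> 1"
  shows "\<exists>S :: (nat pair_pre_digraph \<times> (nat set \<Rightarrow> int)) set.
    infinite S \<and>
    (\<forall>(G, \<sigma>) \<in> S. \<forall>(H, \<tau>) \<in> S. (G, \<sigma>) \<noteq> (H, \<tau>) \<longrightarrow>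
       \<not> digraph_iso (with_proj G) (with_proj H)) \<and>
    (\<forall>(G, \<sigma>) \<in> S.
       signed_graph G \<sigma> \<and>
       Digraph_Component.connected (with_proj G) \<and>
       \<not> balanced G \<sigma> \<and>
       cyclomatic_number G = c \<and>
       int (nullity G \<sigma>) =
         int (card (pverts G)) - 2 * int (matching_number G) + 2 * cyclomatic_number G - s)"
proof -
  obtain L where L: "\<And>i. L i \<in> {3, 4, 6}" and s: "(\<Sum>i<nat c. defect (L i)) = nat s"
  proof -
    have "nat s \<le> 3 * nat c" "nat s \<noteq> 1" using assms by auto
    from exists_cycle_lengths[OF this] that show ?thesis by blast
  qed
  \<comment> \<open>The lengths \<open>L\<close> stay fixed while the number
    \<open>Suc k \<ge> 1\<close> of leaves after the hub varies, so different \<open>k\<close> give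
    different numbers of vertices.\<close>
  define \<G> where "\<G> k = (cycle_star.G (nat c) (Suc k) L, cycle_star.sg (nat c) (Suc k) L)" for k
  have star: "cycle_star (Suc k) L" for k
    using L by unfold_locales auto
  have iso: "k = k'" if "digraph_iso (with_proj (fst (\<G> k))) (with_proj (fst (\<G> k')))" for k k'
    using digraph_iso_card_verts[OF that] by (simp add: \<G>_def cycle_star.pverts_G[OF star])
  have "card (pverts (fst (\<G> k))) = Suc (6 * nat c + Suc k)" for k
    by (simp add: \<G>_def cycle_star.pverts_G[OF star])
  hence "inj \<G>" by (metis (no_types) injI add_left_cancel Suc_inject)
  hence inf: "infinite (range \<G>)" by (rule range_inj_infinite)
  have noniso: "\<not> digraph_iso (with_proj (fst X)) (with_proj (fst Y))"
    if "X \<in> range \<G>" "Y \<in> range \<G>" "X \<noteq> Y" for X Y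
    using that iso by blast
  have props: "signed_graph G \<sigma> \<and> Digraph_Component.connected (with_proj G) \<and> \<not> balanced G \<sigma> \<and>
      cyclomatic_number G = c \<and> int (nullity G \<sigma>) =
         int (card (pverts G)) - 2 * int (matching_number G) + 2 * cyclomatic_number G - s"
    if G: "(G, \<sigma>) \<in> range \<G>" for G \<sigma>
  proof -
    obtain k where Gk: "G = cycle_star.G (nat c) (Suc k) L" "\<sigma> = cycle_star.sg (nat c) (Suc k) L"
      using G by (auto simp: \<G>_def)
    interpret cycle_star "nat c" "Suc k" L by (rule star)
    show ?thesis unfolding Gk
      using signed_graph_G connected_G unbalanced_G cyclomatic_number_G nullity_formula s assms by simp
  qed
  show ?thesis
  proof (intro exI[of _ "range \<G>"] conjI)
    show "\<forall>(G, \<sigma>)\<in>range \<G>. \<forall>(H, \<tau>)\<in>range \<G>. (G, \<sigma>) \<noteq> (H, \<tau>) \<longrightarrow>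
        \<not> digraph_iso (with_proj G) (with_proj H)"
      using noniso by fastforce
  qed (use inf props in blast)+
qed

end
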